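(* Let $n\ge 2$, let $\mathbf A=(A,q,\mathsf e_1,\dots,\mathsf e_n)$ be an $n\mathrm{BA}$, and let $(rk)\in S_n$ be a transposition of $\{1,\dots,n\}$. Then the map $x\mapsto x^{(rk)}$ is an isomorphism from the skew reduct $S_r(\mathbf A)=(A,\land_r,\overline\vee_r,\setminus_r,\mathsf e_r)$ onto the skew reduct $S_k(\mathbf A)=(A,\land_k,\overline\vee_k,\setminus_k,\mathsf e_k)$.
   Context: Let $n\ge 2$. An $n\mathrm{BA}$ (Boolean-like algebra of dimension $n$) is an algebra $\mathbf A=(A,q,\mathsf e_1,\dots,\mathsf e_n)$ with $q$ of arity $n+1$ and constants $\mathsf e_1,\dots,\mathsf e_n$ satisfying the identities (B0) $q(\mathsf e_i,x^1,\dots,x^n)=x^i$ for $i=1,\dots,n$; (B1) $q(y,x,\dots,x)=x$; (B2) $q(y,q(y,x^{11},\dots,x^{1n}),\dots,q(y,x^{n1},\dots,x^{nn}))=q(y,x^{11},x^{22},\dots,x^{nn})$; (B3) $q(y,q(x^{10},\dots,x^{1n}),\dots,q(x^{n0},\dots,x^{nn}))=q(q(y,x^{10},\dots,x^{n0}),\dots,q(y,x^{1n},\dots,x^{nn}))$; (B4) $q(y,\mathsf e_1,\dots,\mathsf e_n)=y$. For $i\in\{1,\dots,n\}$ let $t_i(x,y,z)=q(x,w_1,\dots,w_n)$ with $w_i=z$ and $w_k=y$ for $k\ne i$. Define $x\land_i y=t_i(x,y,\mathsf e_i)$, $x\,\overline\vee_i\,y=t_i(x,x,y)$, $y\setminus_i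 x=t_i(x,\mathsf e_i,y)$. For a permutation $\sigma\in S_n$ let $x^\sigma=q(x,\mathsf e_{\sigma 1},\dots,\mathsf e_{\sigma n})$. The transposition $(rk)$, $r\neq k$, exchanges $r$ and $k$. *)

theory Defs
  imports "HOL-Library.FuncSet" "HOL-Combinatorics.Transposition"
begin

text \<open>
  An \<open>n\<close>-tuple over \<open>A\<close> is an extensional function in \<open>{1..n} \<rightarrow>\<^sub>E A\<close>, so the operation
  \<open>q\<close> of arity \<open>n + 1\<close> takes one element followed by one \<open>n\<close>-tuple, and the tuple
  \<open>(x\<^sup>1, \<dots>, x\<^sup>n)\<close> is written \<open>\<lambda>i\<in>{1..n}. x i\<close>.  The values of \<open>qop\<close> on arguments outside
  \<open>A\<close> or on functions that are not such tuples, and those of \<open>cst\<close> outside \<open>{1..n}\<close>, are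
  irrelevant.
\<close>

record 'a nba_alg =
  univ :: "'a set"
  qop :: "'a \<Rightarrow> (nat \<Rightarrow> 'a) \<Rightarrow> 'a"
  cst :: "nat \<Rightarrow> 'a"

locale nBA =
  fixes n :: nat and \<A> :: "'a nba_alg"
  assumes dim: "n \<ge> 2"
    and q_closed: "\<And>y x. y \<in> univ \<A> \<Longrightarrow> x \<in> {1..n} \<rightarrow>\<^sub>E univ \<A> \<Longrightarrow> qop \<A> y x \<in> univ \<A>"
    and e_closed: "\<And>i. i \<in> {1..n} \<Longrightarrow> cst \<A> i \<in> univ \<A>"
    and B0: "\<And>i x. i \<in> {1..n} \<Longrightarrow> x \<in> {1..n} \<rightarrow>\<^sub>E univ \<A> \<Longrightarrow> qop \<A> (cst \<A> i) x = x i"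
    and B1: "\<And>y x. y \<in> univ \<A> \<Longrightarrow> x \<in> univ \<A> \<Longrightarrow> qop \<A> y (\<lambda>i\<in>{1..n}. x) = x"
    and B2: "\<And>y x. y \<in> univ \<A> \<Longrightarrow> (\<And>i j. i \<in> {1..n} \<Longrightarrow> j \<in> {1..n} \<Longrightarrow> x i j \<in> univ \<A>) \<Longrightarrow>
        qop \<A> y (\<lambda>i\<in>{1..n}. qop \<A> y (\<lambda>j\<in>{1..n}. x i j)) = qop \<A> y (\<lambda>i\<in>{1..n}. x i i)"
    and B3: "\<And>y x. y \<in> univ \<A> \<Longrightarrow> (\<And>i j. i \<in> {1..n} \<Longrightarrow> j \<in> {0..n} \<Longrightarrow> x i j \<in> univ \<A>) \<Longrightarrow>
        qop \<A> y (\<lambda>i\<in>{1..n}. qop \<A> (x i 0) (\<lambda>j\<in>{1..n}. x i j)) =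
        qop \<A> (qop \<A> y (\<lambda>i\<in>{1..n}. x i 0)) (\<lambda>j\<in>{1..n}. qop \<A> y (\<lambda>i\<in>{1..n}. x i j))"
    and B4: "\<And>y. y \<in> univ \<A> \<Longrightarrow> qop \<A> y (\<lambda>i\<in>{1..n}. cst \<A> i) = y"

definition t_op :: "nat \<Rightarrow> 'a nba_alg \<Rightarrow> nat \<Rightarrow> 'a \<Rightarrow> 'a \<Rightarrow> 'a \<Rightarrow> 'a" where
  "t_op n \<A> i x y z = qop \<A> x (\<lambda>k\<in>{1..n}. if k = i then z else y)"

definition perm_act :: "nat \<Rightarrow> 'a nba_alg \<Rightarrow> (nat \<Rightarrow> nat) \<Rightarrow> 'a \<Rightarrow> 'a" where
  "perm_act n \<A> \<sigma> x = qop \<A> x (\<lambda>i\<in>{1..n}. cst \<A> (\<sigma> i))"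

text \<open>Algebras with three binary operations and a constant; \<open>sdiff S y x\<close> is \<open>y \<setminus> x\<close>.\<close>

record 'a skew_alg =
  suniv :: "'a set"
  smeet :: "'a \<Rightarrow> 'a \<Rightarrow> 'a"
  sjoin :: "'a \<Rightarrow> 'a \<Rightarrow> 'a"
  sdiff :: "'a \<Rightarrow> 'a \<Rightarrow> 'a"
  szero :: "'a"

definition skew_reduct :: "nat \<Rightarrow> 'a nba_alg \<Rightarrow> nat \<Rightarrow> 'a skew_alg" where
  "skew_reduct n \<A> i =
    \<lparr>suniv = univ \<A>,
     smeet = (\<lambda>x y. t_op n \<A> i x y (cst \<A> i)),
     sjoin = (\<lambda>x y. t_op n \<A> i x x y),
     sdiff = (\<lambda>y x. t_op n \<A> i x (cst \<A> i) y),
     szero = cst \<A> i\<rparr>"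

definition skew_hom :: "('a \<Rightarrow> 'b) \<Rightarrow> 'a skew_alg \<Rightarrow> 'b skew_alg \<Rightarrow> bool" where
  "skew_hom f S T \<longleftrightarrow>
    f \<in> suniv S \<rightarrow> suniv T \<and>
    (\<forall>x\<in>suniv S. \<forall>y\<in>suniv S. f (smeet S x y) = smeet T (f x) (f y)) \<and>
    (\<forall>x\<in>suniv S. \<forall>y\<in>suniv S. f (sjoin S x y) = sjoin T (f x) (f y)) \<and>
    (\<forall>x\<in>suniv S. \<forall>y\<in>suniv S. f (sdiff S y x) = sdiff T (f y) (f x)) \<and>
    f (szero S) = szero T"

definition skew_iso :: "('a \<Rightarrow> 'b) \<Rightarrow> 'a skew_alg \<Rightarrow> 'b skew_alg \<Rightarrow> bool" where
  "skew_iso f S T \<longleftrightarrow> skew_hom f S T \<and> bij_betw f (suniv S) (suniv T)"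

end

theory Submission
  imports Defs
begin

text \<open>
  Axioms (B1) and (B3) give \<open>q(q(x,y\<^sup>1,\<dots>,y\<^sup>n),w) = q(x,q(y\<^sup>1,w),\<dots>,q(y\<^sup>n,w))\<close>: composition in the
  first argument of \<open>q\<close> is substitution.  Hence a permutation acting on \<open>x\<close> permutes the arguments
  of \<open>q(x,-)\<close>, while acting on a value of \<open>q(x,-)\<close> it acts on each argument.  Comparing the two,
  \<open>x \<mapsto> x\<^sup>\<sigma>\<close> carries the term \<open>t\<^sub>i\<close> to \<open>t\<^sub>j\<close> whenever \<open>\<sigma> i = j\<close>, and all operations of the skew
  reducts are instances of these terms.
\<close>

context nBA
begin

lemma q_in [simp]:
  assumes "y \<in> univ \<A>" and "\<And>i. i \<in> {1..n} \<Longrightarrow> x i \<in> univ \<A>"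
  shows "qop \<A> y (\<lambda>i\<in>{1..n}. x i) \<in> univ \<A>"
  using assms by (intro q_closed) auto

lemma q_q:
  assumes x: "x \<in> univ \<A>" and y: "\<And>i. i \<in> {1..n} \<Longrightarrow> y i \<in> univ \<A>"
    and w: "\<And>j. j \<in> {1..n} \<Longrightarrow> w j \<in> univ \<A>"
  shows "qop \<A> (qop \<A> x (\<lambda>i\<in>{1..n}. y i)) (\<lambda>j\<in>{1..n}. w j) =
    qop \<A> x (\<lambda>i\<in>{1..n}. qop \<A> (y i) (\<lambda>j\<in>{1..n}. w j))"
proof -
  \<comment> \<open>The matrix for (B3): column \<open>0\<close> carries the \<open>y i\<close>, and
    every row carries the same tuple \<open>w\<close>. Each column \<open>j > 0\<close> is then
    constant, so (B1) collapses it to \<open>w j\<close>.\<close>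
  define z where "z i j = (if j = 0 then y i else w j)" for i j :: nat
  have z: "z i j \<in> univ \<A>" if "i \<in> {1..n}" "j \<in> {0..n}" for i j
    using that y w by (auto simp: z_def)
  have z0: "z i 0 = y i" for i
    by (simp add: z_def)
  have zj: "(\<lambda>j\<in>{1..n}. z i j) = (\<lambda>j\<in>{1..n}. w j)" for i
    by (intro restrict_ext) (auto simp: z_def)
  have const: "(\<lambda>j\<in>{1..n}. qop \<A> x (\<lambda>i\<in>{1..n}. z i j)) = (\<lambda>j\<in>{1..n}. w j)"
  proof (rule restrict_ext)
    fix j assume j: "j \<in> {1..n}"
    then have "(\<lambda>i\<in>{1..n}. z i j) = (\<lambda>i\<in>{1..n}. w j)"
      by (intro restrict_ext) (auto simp: z_def)
    then show "qop \<A> x (\<lambda>i\<in>{1..n}. z i j) = w j"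
      using B1[OF x w[OF j]] by simp
  qed
  from B3[of x z, OF x z] show ?thesis
    unfolding z0 zj const by simp
qed

lemma cst_in [simp]:
  assumes "\<sigma> \<in> {1..n} \<rightarrow> {1..n}" and "i \<in> {1..n}"
  shows "cst \<A> (\<sigma> i) \<in> univ \<A>"
  using funcset_mem[OF assms] by (rule e_closed)

lemma perm_act_closed [simp]:
  assumes "x \<in> univ \<A>" and "\<sigma> \<in> {1..n} \<rightarrow> {1..n}"
  shows "perm_act n \<A> \<sigma> x \<in> univ \<A>"
  unfolding perm_act_def using assms by (intro q_in cst_in)

lemma perm_act_cst:
  assumes "i \<in> {1..n}" and "\<sigma> \<in> {1..n} \<rightarrow> {1..n}"
  shows "perm_act n \<A> \<sigma> (cst \<A> i) = cst \<A> (\<sigma> i)"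
  unfolding perm_act_def using assms by (subst B0) (auto simp del: One_nat_def)

text \<open>Substitution by \<open>q_q\<close> puts \<open>q(e_{\<sigma> i}, w)\<close> in place
  \<open>i\<close>, and (B0) selects the component \<open>w (\<sigma> i)\<close>.\<close>

lemma q_perm_act:
  assumes "x \<in> univ \<A>" and \<sigma>: "\<sigma> \<in> {1..n} \<rightarrow> {1..n}"
    and w: "\<And>j. j \<in> {1..n} \<Longrightarrow> w j \<in> univ \<A>"
  shows "qop \<A> (perm_act n \<A> \<sigma> x) (\<lambda>j\<in>{1..n}. w j) = qop \<A> x (\<lambda>i\<in>{1..n}. w (\<sigma> i))"
proof -
  have mem: "\<sigma> i \<in> {1..n}" if "i \<in> {1..n}" for i
    using \<sigma> that by (rule funcset_mem)
  have "qop \<A> (cst \<A> (\<sigma> i)) (\<lambda>j\<in>{1..n}. w j) = w (\<sigma> i)" if "i \<in> {1..n}" for i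
    using B0[OF mem[OF that], of "\<lambda>j\<in>{1..n}. w j"] mem[OF that] w by auto
  then have "(\<lambda>i\<in>{1..n}. qop \<A> (cst \<A> (\<sigma> i)) (\<lambda>j\<in>{1..n}. w j)) = (\<lambda>i\<in>{1..n}. w (\<sigma> i))"
    by (rule restrict_ext)
  then show ?thesis
    unfolding perm_act_def using q_q[of x "\<lambda>i. cst \<A> (\<sigma> i)" w] assms(1) mem e_closed w by simp
qed

text \<open>This is \<open>q_q\<close> with the constants \<open>cst \<A> (\<sigma> j)\<close> as
  the outer tuple.\<close>

lemma perm_act_q:
  assumes "x \<in> univ \<A>" and "\<sigma> \<in> {1..n} \<rightarrow> {1..n}"
    and "\<And>i. i \<in> {1..n} \<Longrightarrow> w i \<in> univ \<A>"
  shows "perm_act n \<A> \<sigma> (qop \<A> x (\<lambda>i\<in>{1..n}. w i)) =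
    qop \<A> x (\<lambda>i\<in>{1..n}. perm_act n \<A> \<sigma> (w i))"
  unfolding perm_act_def using assms by (intro q_q cst_in)

lemma perm_act_perm_act:
  assumes "x \<in> univ \<A>" and "\<sigma> \<in> {1..n} \<rightarrow> {1..n}" and "\<tau> \<in> {1..n} \<rightarrow> {1..n}"
  shows "perm_act n \<A> \<tau> (perm_act n \<A> \<sigma> x) = perm_act n \<A> (\<tau> \<circ> \<sigma>) x"
  using q_perm_act[OF assms(1,2), of "\<lambda>j. cst \<A> (\<tau> j)"] assms(3) by (simp add: perm_act_def)

lemma perm_act_t_op:
  assumes "x \<in> univ \<A>" "y \<in> univ \<A>" "z \<in> univ \<A>"
    and \<sigma>: "bij_betw \<sigma> {1..n} {1..n}" and i: "i \<in> {1..n}"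
  shows "perm_act n \<A> \<sigma> (t_op n \<A> i x y z) =
    t_op n \<A> (\<sigma> i) (perm_act n \<A> \<sigma> x) (perm_act n \<A> \<sigma> y) (perm_act n \<A> \<sigma> z)"
proof -
  have fs: "\<sigma> \<in> {1..n} \<rightarrow> {1..n}"
    using \<sigma> by (rule bij_betw_imp_funcset)
  have eq: "\<sigma> m = \<sigma> i \<longleftrightarrow> m = i" if "m \<in> {1..n}" for m
    using bij_betw_imp_inj_on[OF \<sigma>] that i by (rule inj_on_eq_iff)
  have "perm_act n \<A> \<sigma> (t_op n \<A> i x y z) =
      qop \<A> x (\<lambda>m\<in>{1..n}. perm_act n \<A> \<sigma> (if m = i then z else y))"
    unfolding t_op_def using assms fs by (intro perm_act_q) auto
  \<comment> \<open>Injectivity of \<sigma> turns the test \<open>m = i\<close> into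
    \<open>\<sigma> m = \<sigma> i\<close>. The tuple now has the form
    \<open>w (\<sigma> m)\<close>, so \<open>q_perm_act\<close> read from right to left moves
    \<sigma> onto \<open>x\<close>.\<close>
  also have "(\<lambda>m\<in>{1..n}. perm_act n \<A> \<sigma> (if m = i then z else y)) =
      (\<lambda>m\<in>{1..n}. if \<sigma> m = \<sigma> i then perm_act n \<A> \<sigma> z else perm_act n \<A> \<sigma> y)"
    by (intro restrict_ext) (auto simp: eq)
  also have "qop \<A> x \<dots> =
      t_op n \<A> (\<sigma> i) (perm_act n \<A> \<sigma> x) (perm_act n \<A> \<sigma> y) (perm_act n \<A> \<sigma> z)"
    unfolding t_op_def using assms(1-3) fs by (intro q_perm_act[symmetric]) auto
  finally show ?thesis .
qed

text \<open>Each operation is \<open>t_op\<close> at index \<open>i\<close> applied to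
  \<open>x\<close>, \<open>y\<close> and \<open>cst \<A> i\<close>, and the action sends
  \<open>cst \<A> i\<close> to \<open>cst \<A> (\<sigma> i)\<close>.\<close>

lemma skew_hom_perm_act:
  assumes \<sigma>: "bij_betw \<sigma> {1..n} {1..n}" and i: "i \<in> {1..n}"
  shows "skew_hom (perm_act n \<A> \<sigma>) (skew_reduct n \<A> i) (skew_reduct n \<A> (\<sigma> i))"
  using bij_betw_imp_funcset[OF \<sigma>] i e_closed
  by (simp add: skew_hom_def skew_reduct_def perm_act_t_op[OF _ _ _ \<sigma> i] perm_act_cst)

text \<open>The inverse map is the action of the inverse permutation, since actions compose and the
  identity acts trivially by (B4).\<close>

lemma bij_betw_perm_act:
  assumes \<sigma>: "bij_betw \<sigma> {1..n} {1..n}"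
  shows "bij_betw (perm_act n \<A> \<sigma>) (univ \<A>) (univ \<A>)"
proof -
  let ?\<tau> = "inv_into {1..n} \<sigma>"
  have \<tau>: "bij_betw ?\<tau> {1..n} {1..n}"
    using \<sigma> by (rule bij_betw_inv_into)
  note fs = bij_betw_imp_funcset[OF \<sigma>] bij_betw_imp_funcset[OF \<tau>]
  \<comment> \<open>Agreement with the identity is asked only on \<open>{1..n}\<close>, because
    \<open>inv_into\<close> inverts \<sigma> only there.\<close>
  have id: "perm_act n \<A> \<rho> x = x" if "x \<in> univ \<A>" "\<And>i. i \<in> {1..n} \<Longrightarrow> \<rho> i = i" for \<rho> x
    using B4[OF that(1)] that(2) by (simp add: perm_act_def cong: restrict_cong)
  have "perm_act n \<A> (?\<tau> \<circ> \<sigma>) x = x" "perm_act n \<A> (\<sigma> \<circ> ?\<tau>) x = x" if "x \<in> univ \<A>" for x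
    using bij_betw_inv_into_left[OF \<sigma>] bij_betw_inv_into_right[OF \<sigma>]
    by (auto intro!: id that simp del: One_nat_def)
  then show ?thesis
    by (intro bij_betw_byWitness[where f' = "perm_act n \<A> ?\<tau>"])
      (auto simp: perm_act_perm_act fs simp del: One_nat_def)
qed

lemma skew_iso_perm_act:
  assumes "bij_betw \<sigma> {1..n} {1..n}" and "i \<in> {1..n}"
  shows "skew_iso (perm_act n \<A> \<sigma>) (skew_reduct n \<A> i) (skew_reduct n \<A> (\<sigma> i))"
  using skew_hom_perm_act[OF assms] bij_betw_perm_act[OF assms(1)]
  by (simp add: skew_iso_def skew_reduct_def)

end

theorem theorem4p9:
  fixes n r k :: nat and \<A> :: "'a nba_alg"
  assumes "nBA n \<A>"
    and "r \<in> {1..n}" and "k \<in> {1..n}" and "r \<noteq> k"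
  shows "skew_iso (perm_act n \<A> (Transposition.transpose r k)) (skew_reduct n \<A> r) (skew_reduct n \<A> k)"
proof -
  have "bij_betw (Transposition.transpose r k) {1..n} {1..n}"
    using assms(2,3) by simp
  \<comment> \<open>The transposition sends \<open>r\<close> to \<open>k\<close>, so the target
    reduct is the one at \<open>k\<close>.\<close>
  from nBA.skew_iso_perm_act[OF assms(1) this assms(2)] show ?thesis
    by simp
qed

end
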